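(* For every $n \in \mathbb{N}$, \[ f(n) \ge 2\sqrt{n}, \] where \[ f(n) := \inf_{s_1,\dots,s_n \ge 1} \ \max_{|z|=1} \left| \prod_{j=1}^n (1 - z^{s_j}) \right|, \] the infimum being taken over all $n$-tuples $(s_1,\dots,s_n)$ of positive integers (not necessarily distinct) and the maximum over all complex numbers $z$ with $|z|=1$.
   Context: $\mathbb{N}$ denotes the set of positive integers. *)

theory Defs
  imports "HOL-Analysis.Analysis"
begin

definition circle_max :: "nat \<Rightarrow> (nat \<Rightarrow> nat) \<Rightarrow> real" where
  "circle_max n s = (SUP z \<in> sphere (0::complex) 1. norm (\<Prod>j = 1..n. (1 - z ^ s j)))"

text \<open>The supremum is attained, so it is the maximum of the modulus over the unit circle.\<close>

lemma circle_max_attained: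
  "\<exists>z \<in> sphere (0::complex) 1. circle_max n s = norm (\<Prod>j = 1..n. (1 - z ^ s j))
     \<and> (\<forall>w \<in> sphere (0::complex) 1. norm (\<Prod>j = 1..n. (1 - w ^ s j)) \<le> circle_max n s)"
proof -
  let ?g = "\<lambda>z::complex. norm (\<Prod>j = 1..n. (1 - z ^ s j))"
  have "continuous_on (sphere 0 1) ?g"
    by (intro continuous_intros)
  then obtain z where z: "z \<in> sphere (0::complex) 1" "\<And>w. w \<in> sphere 0 1 \<Longrightarrow> ?g w \<le> ?g z"
    using continuous_attains_sup[of "sphere (0::complex) 1" ?g] by fastforce
  then have "circle_max n s = ?g z"
    unfolding circle_max_def by (intro cSup_eq_maximum) auto
  with z show ?thesis by auto
qed

text \<open>The infimum over all \<open>n\<close>-tuples of positive integers, indexed by \<open>{1..n}\<close>. The index set is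
  nonempty and the values are bounded below by \<open>0\<close>, so it is a genuine infimum of reals.\<close>

definition erdos_szekeres_f :: "nat \<Rightarrow> real" where
  "erdos_szekeres_f n = (INF s \<in> {1..n} \<rightarrow>\<^sub>E {1::nat..}. circle_max n s)"

lemma circle_max_nonneg: "0 \<le> circle_max n s"
  using circle_max_attained[of n s] by auto

lemma tuples_nonempty: "({1..n::nat} \<rightarrow>\<^sub>E {1::nat..}) \<noteq> {}"
  by (simp add: PiE_eq_empty_iff)

lemma circle_max_bdd_below: "bdd_below (circle_max n ` ({1..n} \<rightarrow>\<^sub>E {1::nat..}))"
  by (rule bdd_belowI2[where m = 0]) (rule circle_max_nonneg)

end

theory Submission
  imports Defs "HOL-Complex_Analysis.Complex_Analysis"
    "HOL-Computational_Algebra.Computational_Algebra"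
begin

text \<open>
  Let \<open>P(z) = \<Prod>(1 - z^s\<^sub>j)\<close> have degree \<open>D\<close>, coefficients \<open>a\<^sub>k\<close> and maximum \<open>M\<close> on the unit circle.
  The classical bound \<open>\<Sum>a\<^sub>k\<^sup>2 \<ge> \<Sum>\<bar>a\<^sub>k\<bar> \<ge> 2n\<close> comes from the zero of order \<open>n\<close> at \<open>1\<close>, and Parseval then
  gives \<open>M\<^sup>2 \<ge> 2n\<close>. The extra factor \<open>2\<close> is the \<open>L\<^sup>2\<close> case of a theorem of Saff and Sheil-Small:
  a polynomial all of whose zeros lie on the unit circle satisfies \<open>\<Sum>\<bar>a\<^sub>k\<bar>\<^sup>2 \<le> M\<^sup>2 / 2\<close>. Indeed,
  \<open>P = H (1 - \<phi>)\<close> in the open disc, where \<open>H = (D P - z P') / D\<close> is bounded by \<open>M / 2\<close> and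
  \<open>\<phi> = - z P' / (D P - z P')\<close> is holomorphic with \<open>\<bar>\<phi>\<bar> \<le> 1\<close> and \<open>\<phi>(0) = 0\<close>. Hence
  \<open>\<bar>P\<bar>\<^sup>2 \<le> (M\<^sup>2 / 4) (2 - 2 Re \<phi>)\<close>, and \<open>Re \<phi>\<close> has mean \<open>0\<close> on every circle \<open>\<bar>z\<bar> = r < 1\<close>.
\<close>

section \<open>Integrals over circles\<close>

text \<open>Cauchy's formula at the centre: along the parametrized circle, \<open>dz / z\<close> is
  \<open>\<i> dt\<close>, so the contour integral becomes a mean value.\<close>

lemma circle_integral_holomorphic:
  assumes "f holomorphic_on cball 0 r" "0 < r"
  shows "((\<lambda>t. f (of_real r * cis t)) has_integral 2 * of_real pi * f 0) {0..2*pi}"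
proof -
  have "((\<lambda>u. f u / (u - 0)) has_contour_integral 2 * of_real pi * \<i> * f 0) (circlepath 0 r)"
    using assms by (intro Cauchy_integral_circlepath_simple) auto
  then have "((\<lambda>t. f (of_real r * cis t) / (of_real r * cis t) * r * \<i> * cis t)
      has_integral 2 * of_real pi * \<i> * f 0) {0..2*pi}"
    by (simp add: circlepath_def has_contour_integral_part_circlepath_iff)
  then have "((\<lambda>t. f (of_real r * cis t) / (of_real r * cis t) * r * \<i> * cis t * (- \<i>))
      has_integral 2 * of_real pi * \<i> * f 0 * (- \<i>)) {0..2*pi}"
    by (rule has_integral_mult_left)
  then show ?thesis
    using assms(2) by (simp add: field_simps)
qed

text \<open>For \<open>k \<le> j\<close> the integrand is a constant times the holomorphic
  \<open>z ^ (j - k)\<close>, whose mean is its value at the centre. The case \<open>j < k\<close>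
  follows by conjugation.\<close>

lemma circle_integral_monomials:
  assumes "0 < r"
  shows "((\<lambda>t. (of_real r * cis t) ^ j * cnj ((of_real r * cis t) ^ k)) has_integral
           (if j = k then 2 * of_real pi * of_real (r ^ (2 * k)) else 0)) {0..2*pi}"
proof -
  have ge: "((\<lambda>t. (of_real r * cis t) ^ j * cnj ((of_real r * cis t) ^ k)) has_integral
           (if j = k then 2 * of_real pi * of_real (r ^ (2 * k)) else 0)) {0..2*pi}"
    if "k \<le> j" for j k
  proof -
    have eq: "(of_real r * cis t) ^ j * cnj ((of_real r * cis t) ^ k)
        = of_real (r ^ (2 * k)) * (of_real r * cis t) ^ (j - k)" for t
    proof -
      let ?z = "of_real r * cis t"
      have "?z ^ j = ?z ^ (j - k) * ?z ^ k"
        using that by (metis le_add_diff_inverse2 power_add)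
      then have "?z ^ j * cnj (?z ^ k) = ?z ^ (j - k) * (?z * cnj ?z) ^ k"
        by (simp only: complex_cnj_power power_mult_distrib[of ?z "cnj ?z"])
           (simp only: mult.assoc)
      also have "?z * cnj ?z = of_real ((cmod ?z)\<^sup>2)"
        by (simp only: complex_norm_square)
      also have "(cmod ?z)\<^sup>2 = r\<^sup>2"
        by (simp add: norm_mult)
      finally show ?thesis by (metis mult.commute of_real_power power_mult)
    qed
    have "((\<lambda>t. of_real (r ^ (2 * k)) * (of_real r * cis t) ^ (j - k)) has_integral
        of_real (r ^ (2 * k)) * (2 * of_real pi * 0 ^ (j - k))) {0..2*pi}"
      using assms by (intro has_integral_mult_right circle_integral_holomorphic holomorphic_intros)
    then show ?thesis using that unfolding eq
      by (auto simp: power_0_left mult.commute split: if_splits)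
  qed
  show ?thesis
  proof (cases "k \<le> j")
    case False
    then show ?thesis
      using has_integral_cnj[THEN iffD2, OF ge[of j k]] by (simp add: mult.commute o_def)
  qed (use ge in auto)
qed

text \<open>Parseval's identity: orthogonality of the monomials leaves only the diagonal of the
  double sum.\<close>

lemma circle_integral_norm_poly_square:
  fixes p :: "complex poly"
  assumes "0 < r"
  shows "((\<lambda>t. (cmod (poly p (of_real r * cis t)))\<^sup>2) has_integral
           2 * pi * (\<Sum>k\<le>degree p. (cmod (coeff p k))\<^sup>2 * r ^ (2 * k))) {0..2*pi}"
proof -
  let ?z = "\<lambda>t. of_real r * cis t"
  have eq: "(\<Sum>j\<le>degree p. \<Sum>k\<le>degree p. coeff p j * cnj (coeff p k) * (?z t ^ j * cnj (?z t ^ k)))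
      = of_real ((cmod (poly p (?z t)))\<^sup>2)" for t
    by (simp only: complex_norm_square poly_altdef cnj_sum sum_product complex_cnj_mult mult_ac)
  have "((\<lambda>t. \<Sum>j\<le>degree p. \<Sum>k\<le>degree p. coeff p j * cnj (coeff p k) * (?z t ^ j * cnj (?z t ^ k)))
      has_integral (\<Sum>j\<le>degree p. \<Sum>k\<le>degree p. coeff p j * cnj (coeff p k) *
        (if j = k then 2 * of_real pi * of_real (r ^ (2 * k)) else 0))) {0..2*pi}"
    by (intro has_integral_sum has_integral_mult_right circle_integral_monomials assms) auto
  also have "(\<Sum>j\<le>degree p. \<Sum>k\<le>degree p. coeff p j * cnj (coeff p k) *
        (if j = k then 2 * of_real pi * of_real (r ^ (2 * k)) else 0))
      = of_real (2 * pi * (\<Sum>k\<le>degree p. (cmod (coeff p k))\<^sup>2 * r ^ (2 * k)))"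
    by (simp add: if_distrib sum.delta cong: if_cong)
       (simp add: sum_distrib_left complex_norm_square mult_ac flip: of_real_power)
  finally have "((\<lambda>t. complex_of_real ((cmod (poly p (?z t)))\<^sup>2)) has_integral
      of_real (2 * pi * (\<Sum>k\<le>degree p. (cmod (coeff p k))\<^sup>2 * r ^ (2 * k)))) {0..2*pi}"
    unfolding eq .
  from has_integral_Re[OF this] show ?thesis unfolding Re_complex_of_real .
qed


section \<open>Polynomials with zeros on the unit circle\<close>

lemma norm_le_norm_diff_iff:
  fixes w :: complex and d :: real
  assumes "d > 0"
  shows "cmod w \<le> cmod (of_real d - w) \<longleftrightarrow> Re w \<le> d / 2"
proof -
  have "cmod w \<le> cmod (of_real d - w) \<longleftrightarrow> (cmod w)\<^sup>2 \<le> (cmod (of_real d - w))\<^sup>2"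
    by simp
  also have "\<dots> \<longleftrightarrow> d * (2 * Re w) \<le> d * d"
    unfolding cmod_power2 by (auto simp: power2_eq_square algebra_simps)
  finally show ?thesis using assms by (simp add: mult.commute)
qed

text \<open>With \<open>u = z / (z - a)\<close> one has \<open>1 - u = - a / (z - a)\<close>, so the
  hypothesis says that \<open>u\<close> is at least as close to 0 as to 1.\<close>

lemma Re_divide_diff_le_half:
  fixes z a :: complex
  assumes "cmod z \<le> cmod a" "z \<noteq> a"
  shows "Re (z / (z - a)) \<le> 1 / 2"
proof -
  have "1 - z / (z - a) = - a / (z - a)"
    using assms by (simp add: field_simps)
  then have "cmod (z / (z - a)) \<le> cmod (of_real 1 - z / (z - a))"
    using assms by (simp add: norm_divide divide_right_mono)
  then show ?thesis by (subst (asm) norm_le_norm_diff_iff) auto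
qed

text \<open>Exchanging \<open>z\<close> and \<open>a\<close> gives two numbers with sum 1, each with
  real part at most 1/2.\<close>

lemma Re_divide_diff_eq_half:
  fixes z a :: complex
  assumes "cmod z = cmod a" "z \<noteq> a"
  shows "Re (z / (z - a)) = 1 / 2"
proof -
  have "a / (a - z) = - a / (z - a)"
    by (metis minus_diff_eq minus_divide_divide)
  then have "z / (z - a) + a / (a - z) = 1"
    using assms by (simp flip: diff_divide_distrib)
  then have "Re (z / (z - a)) + Re (a / (a - z)) = 1"
    by (metis one_complex.sel(1) plus_complex.sel(1))
  with Re_divide_diff_le_half[of z a] Re_divide_diff_le_half[of a z] assms show ?thesis
    by force
qed

section \<open>Logarithmic derivatives in terms of the roots\<close>

lemma logderiv_linear_factors:
  fixes A :: "complex multiset"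
  assumes "c \<noteq> 0" "z \<notin># A"
  shows "poly (pderiv (smult c (\<Prod>x\<in>#A. [:- x, 1:]))) z / poly (smult c (\<Prod>x\<in>#A. [:- x, 1:])) z
           = (\<Sum>x\<in>#A. 1 / (z - x))"
  using assms(2)
proof (induction A)
  case (add x A)
  define f where "f = poly (\<Prod>x\<in>#A. [:- x, 1:]) z"
  define g where "g = (\<Sum>x\<in>#A. 1 / (z - x))"
  have "f \<noteq> 0"
    using add.prems by (auto simp: f_def poly_prod_mset image_iff)
  have "poly (pderiv (\<Prod>x\<in>#A. [:- x, 1:])) z = g * f"
    using add assms(1) \<open>f \<noteq> 0\<close> by (simp add: pderiv_smult f_def g_def field_simps)
  then have "poly (pderiv (smult c (\<Prod>x\<in>#add_mset x A. [:- x, 1:]))) z = c * (f + (z - x) * (g * f))"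
    by (simp add: pderiv_smult pderiv_mult pderiv_pCons f_def algebra_simps del: mult_pCons_left)
  moreover have "poly (smult c (\<Prod>x\<in>#add_mset x A. [:- x, 1:])) z = c * ((z - x) * f)"
    by (simp add: f_def algebra_simps)
  moreover have "c * (f + (z - x) * (g * f)) / (c * ((z - x) * f)) = 1 / (z - x) + g"
    using \<open>f \<noteq> 0\<close> \<open>c \<noteq> 0\<close> add.prems by (simp add: add_divide_distrib)
  ultimately show ?case by (simp only: g_def image_mset_add_mset sum_mset.add_mset)
qed (simp add: pderiv_smult)

text \<open>Splitting into linear factors, with \<open>A\<close> the roots counted with
  multiplicity, reduces estimates of the logarithmic derivative to a single root.\<close>

lemma logderiv_roots:
  fixes p :: "complex poly"
  assumes "poly p z \<noteq> 0"
  obtains A where "size A = degree p" "\<And>x. x \<in># A \<Longrightarrow> poly p x = 0"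
    "z * poly (pderiv p) z / poly p z = (\<Sum>x\<in>#A. z / (z - x))"
proof -
  from assms have "p \<noteq> 0" by auto
  define c where "c = lead_coeff p"
  obtain A where A: "size A = degree p" "p = smult c (\<Prod>x\<in>#A. [:- x, 1:])"
    using alg_closed_imp_factorization[OF \<open>p \<noteq> 0\<close>, folded c_def] by (elim exE conjE)
  have roots: "poly p x = 0" if "x \<in># A" for x
    unfolding A(2) using that by (auto simp: poly_prod_mset image_iff)
  have "c \<noteq> 0" "z \<notin># A"
    using \<open>p \<noteq> 0\<close> assms roots by (auto simp: c_def)
  then have "poly (pderiv p) z / poly p z = (\<Sum>x\<in>#A. 1 / (z - x))"
    unfolding A(2) by (rule logderiv_linear_factors)
  then have "z * poly (pderiv p) z / poly p z = z * (\<Sum>x\<in>#A. 1 / (z - x))"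
    by (metis times_divide_eq_right)
  also have "\<dots> = (\<Sum>x\<in>#A. z / (z - x))"
    by (simp add: sum_mset_distrib_left)
  finally show ?thesis using that[OF A(1) roots] by simp
qed

lemma Re_logderiv_le:
  fixes p :: "complex poly"
  assumes "\<And>a. poly p a = 0 \<Longrightarrow> cmod z \<le> cmod a" "poly p z \<noteq> 0"
  shows "Re (z * poly (pderiv p) z / poly p z) \<le> degree p / 2"
proof -
  obtain A where A: "size A = degree p" "\<And>x. x \<in># A \<Longrightarrow> poly p x = 0"
    "z * poly (pderiv p) z / poly p z = (\<Sum>x\<in>#A. z / (z - x))"
    using logderiv_roots assms(2) by blast
  have "Re (z / (z - x)) \<le> 1 / 2" if "x \<in># A" for x
    using that A(2) assms by (intro Re_divide_diff_le_half) auto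
  then have "Re (\<Sum>x\<in>#A. z / (z - x)) \<le> size A / 2"
    by (induction A) (force simp: add_divide_distrib)+
  then show ?thesis using A by simp
qed

lemma Re_logderiv_eq:
  fixes p :: "complex poly"
  assumes "\<And>a. poly p a = 0 \<Longrightarrow> cmod z = cmod a" "poly p z \<noteq> 0"
  shows "Re (z * poly (pderiv p) z / poly p z) = degree p / 2"
proof -
  obtain A where A: "size A = degree p" "\<And>x. x \<in># A \<Longrightarrow> poly p x = 0"
    "z * poly (pderiv p) z / poly p z = (\<Sum>x\<in>#A. z / (z - x))"
    using logderiv_roots assms(2) by blast
  have "Re (z / (z - x)) = 1 / 2" if "x \<in># A" for x
    using that A(2) assms by (intro Re_divide_diff_eq_half) auto
  then have "Re (\<Sum>x\<in>#A. z / (z - x)) = size A / 2"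
    by (induction A) (force simp: add_divide_distrib)+
  then show ?thesis using A by simp
qed

text \<open>Dividing by \<open>poly p z\<close> turns this into the half-plane criterion for
  \<open>w = z p' / p\<close>; at a zero of \<open>p\<close> both sides agree.\<close>

lemma norm_logderiv_le:
  fixes p :: "complex poly"
  assumes "\<And>a. poly p a = 0 \<Longrightarrow> cmod z \<le> cmod a" "degree p > 0"
  shows "cmod (z * poly (pderiv p) z) \<le> cmod (of_nat (degree p) * poly p z - z * poly (pderiv p) z)"
proof (cases "poly p z = 0")
  case False
  let ?w = "z * poly (pderiv p) z / poly p z"
  have "cmod ?w \<le> cmod (of_real (degree p) - ?w)"
    using norm_le_norm_diff_iff[of "degree p" ?w] Re_logderiv_le[OF assms(1) False] assms(2) by simp
  then have "cmod ?w * cmod (poly p z) \<le> cmod (of_real (degree p) - ?w) * cmod (poly p z)"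
    by (rule mult_right_mono) simp
  then show ?thesis using False by (simp add: norm_mult[symmetric] left_diff_distrib)
qed auto

lemma norm_logderiv_eq:
  fixes p :: "complex poly"
  assumes "\<And>a. poly p a = 0 \<Longrightarrow> cmod z = cmod a"
  shows "cmod (z * poly (pderiv p) z) = cmod (of_nat (degree p) * poly p z - z * poly (pderiv p) z)"
proof (cases "poly p z = 0")
  case False
  let ?w = "z * poly (pderiv p) z / poly p z"
  have "Re ?w = degree p / 2"
    using Re_logderiv_eq[OF assms False] by simp
  then have "(cmod ?w)\<^sup>2 = (cmod (of_real (degree p) - ?w))\<^sup>2"
    unfolding cmod_power2 by (auto simp: power2_eq_square algebra_simps)
  then have "cmod ?w * cmod (poly p z) = cmod (of_real (degree p) - ?w) * cmod (poly p z)"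
    by simp
  then show ?thesis using False by (simp add: norm_mult[symmetric] left_diff_distrib)
qed auto

lemma poly_maximum_modulus:
  fixes p :: "complex poly"
  assumes "\<And>z. cmod z = 1 \<Longrightarrow> cmod (poly p z) \<le> B" "cmod z \<le> 1"
  shows "cmod (poly p z) \<le> B"
proof (rule maximum_modulus_frontier[of "poly p" "cball 0 1"])
  show "poly p holomorphic_on interior (cball 0 1)"
    by (intro holomorphic_intros)
  show "continuous_on (closure (cball 0 1)) (poly p)"
    by (intro continuous_intros)
qed (use assms in auto)

text \<open>For \<open>\<bar>\<lambda>\<bar> > M\<close> the polynomial \<open>p - \<lambda>\<close> has no zeros in the closed disc, so
  the logarithmic derivative estimate applies to it; \<open>\<lambda>\<close> is chosen in the direction
  of \<open>D p - z p'\<close>.\<close>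

lemma norm_reversed_deriv_le:
  fixes p :: "complex poly" and M :: real
  assumes unit: "\<And>a. poly p a = 0 \<Longrightarrow> cmod a = 1" and D: "degree p > 0"
    and M: "\<And>z. cmod z = 1 \<Longrightarrow> cmod (poly p z) \<le> M" and z: "cmod z = 1" and "M > 0"
  shows "cmod (of_nat (degree p) * poly p z - z * poly (pderiv p) z) \<le> degree p * M / 2"
proof (rule ccontr)
  define D where "D = degree p"
  define h where "h = of_nat D * poly p z - z * poly (pderiv p) z"
  define x where "x = cmod h"
  assume "\<not> ?thesis"
  then have "D * M < 2 * x" by (simp add: x_def h_def D_def)
  \<comment> \<open>Both inequalities matter: the first gives \<open>cmod c = y / D > M\<close>, the
    second makes \<open>\<bar>x - y\<bar> < x\<close>.\<close>
  then obtain y where y: "D * M < y" "y < 2 * x"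
    using dense by blast
  have "D > 0" using D by (simp add: D_def)
  have "real D * M > 0" using \<open>D > 0\<close> \<open>M > 0\<close> by simp
  then have "x > 0" "y > 0" using y by linarith+
  define c where "c = of_real (y / (D * x)) * h"
  have "cmod c = y / D"
    using \<open>x > 0\<close> \<open>D > 0\<close> \<open>y > 0\<close> unfolding c_def norm_mult norm_of_real x_def[symmetric]
    by simp
  then have c: "cmod c > M" using y \<open>D > 0\<close> by (simp add: pos_less_divide_eq mult.commute)
  define q where "q = p - [:c:]"
  have deg: "degree q = D"
    unfolding q_def D_def diff_conv_add_uminus
    by (rule degree_add_eq_left) (use D in simp)
  have "cmod z \<le> cmod a" if "poly q a = 0" for a
  proof (rule ccontr)
    assume "\<not> ?thesis"
    then have "cmod (poly p a) \<le> M" using z M by (intro poly_maximum_modulus[of p M a]) auto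
    with that c show False by (simp add: q_def)
  qed
  then have "cmod (z * poly (pderiv q) z) \<le> cmod (of_nat D * poly q z - z * poly (pderiv q) z)"
    using norm_logderiv_le[of q z] deg \<open>D > 0\<close> by auto
  moreover have "pderiv q = pderiv p" by (simp add: q_def pderiv_diff)
  \<comment> \<open>Since \<open>D * c = (y / x) * h\<close>, the right-hand side has modulus
    \<open>\<bar>x - y\<bar>\<close>. The left-hand side has modulus \<open>x\<close>, because
    \<open>p\<close> has its zeros on the circle through \<open>z\<close>.\<close>
  moreover have "of_nat D * poly q z - z * poly (pderiv p) z = of_real (1 - y / x) * h"
    using \<open>x > 0\<close> \<open>D > 0\<close> by (simp add: q_def c_def h_def algebra_simps)
  moreover have "cmod (z * poly (pderiv p) z) = x"
    using norm_logderiv_eq[of p z] unit z by (simp add: x_def h_def D_def)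
  ultimately have "x \<le> cmod (of_real (1 - y / x) * h)" by simp
  also have "\<dots> = \<bar>1 - y / x\<bar> * x" unfolding norm_mult norm_of_real x_def[symmetric] ..
  also have "\<dots> = \<bar>(1 - y / x) * x\<bar>" using \<open>x > 0\<close> by (simp add: abs_mult)
  also have "(1 - y / x) * x = x - y" using \<open>x > 0\<close> by (simp add: left_diff_distrib)
  finally show False using y \<open>y > 0\<close> by linarith
qed


section \<open>The Prouhet--Tarry--Escott bound\<close>

text \<open>The operator \<open>z d/dz\<close> lowers the order of a zero at 1 by at most
  one.\<close>

lemma root_power_dvd_theta:
  fixes p :: "'a::idom poly"
  assumes "[:-1, 1:] ^ Suc n dvd p"
  shows "[:-1, 1:] ^ n dvd pCons 0 (pderiv p)"
proof -
  define l :: "'a poly" where "l = [:-1, 1:]"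
  obtain q where q: "p = l ^ Suc n * q" using assms unfolding l_def by blast
  have "pderiv p = l ^ n * (l * pderiv q + q * (of_nat (Suc n) * pderiv l))"
    unfolding q pderiv_mult pderiv_power_Suc by (simp add: algebra_simps of_nat_poly)
  then have "[:-1, 1:] ^ n dvd pderiv p" unfolding l_def by simp
  then have "[:-1, 1:] ^ n dvd [:0, 1:] * pderiv p" by (rule dvd_mult)
  then show ?thesis by simp
qed

lemma coeff_theta: "coeff (pCons 0 (pderiv p)) k = of_nat k * coeff p k"
  by (cases k) (auto simp: coeff_pderiv)

text \<open>Applying \<open>z d/dz\<close> to \<open>p\<close> exactly \<open>i\<close> times
  multiplies the coefficients by \<open>k ^ i\<close> and leaves a zero at 1, where the coefficient
  sum is read off.\<close>

lemma power_sums_vanish: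
  fixes p :: "int poly"
  assumes "[:-1, 1:] ^ n dvd p" "i < n" "degree p \<le> N"
  shows "(\<Sum>k\<le>N. coeff p k * int k ^ i) = 0"
  using assms
proof (induction i arbitrary: n p)
  case 0
  have "[:-1, 1:] dvd p" using 0 by (meson dvd_power dvd_trans)
  then have "poly p 1 = 0" by (simp add: poly_eq_0_iff_dvd)
  moreover have "poly p 1 = (\<Sum>k\<le>N. coeff p k * 1 ^ k)"
    unfolding poly_altdef using 0 by (intro sum.mono_neutral_left) (auto simp: coeff_eq_0)
  ultimately show ?case by simp
next
  case (Suc i)
  then obtain m where m: "n = Suc m" "i < m" by (cases n) auto
  have "degree (pCons 0 (pderiv p)) \<le> N"
    using Suc.prems(3) by (intro degree_le) (simp add: coeff_theta coeff_eq_0 del: coeff_pCons)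
  then have "(\<Sum>k\<le>N. coeff (pCons 0 (pderiv p)) k * int k ^ i) = 0"
    using Suc.IH[of m "pCons 0 (pderiv p)"] Suc.prems(1) m root_power_dvd_theta by auto
  then show ?case by (simp add: coeff_theta mult_ac)
qed

section \<open>Newton's identities for reciprocal polynomials\<close>

text \<open>The multiset containing \<open>k\<close> with multiplicity \<open>e k\<close> is encoded
  by a polynomial with constant term 1, whose logarithmic derivative generates the power
  sums.\<close>

definition recip_prod :: "(nat \<Rightarrow> nat) \<Rightarrow> nat \<Rightarrow> real poly" where
  "recip_prod e N = (\<Prod>k\<le>N. [:1, - real k:] ^ e k)"

lemma degree_recip_prod: "degree (recip_prod e N) \<le> (\<Sum>k\<le>N. e k)"
proof -
  have "degree (recip_prod e N) \<le> (\<Sum>k\<le>N. degree ([:1, - real k:] ^ e k))"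
    unfolding recip_prod_def using degree_prod_sum_le[of "{..N}" "\<lambda>k. [:1, - real k:] ^ e k"]
    by (simp add: o_def)
  also have "\<dots> \<le> (\<Sum>k\<le>N. e k)"
  proof (rule sum_mono)
    fix k show "degree ([:1, - real k:] ^ e k) \<le> e k"
      using degree_power_le[of "[:1, - real k:]" "e k"] by (auto split: if_splits)
  qed
  finally show ?thesis .
qed

lemma geometric_fps:
  fixes c :: "'a::comm_ring_1"
  shows "fps_of_poly [:1, - c:] * Abs_fps (\<lambda>j. c ^ j) = 1"
proof (rule fps_ext)
  fix n
  show "(fps_of_poly [:1, - c:] * Abs_fps (\<lambda>j. c ^ j)) $ n = 1 $ n"
    by (cases n) (simp_all add: fps_of_poly_pCons algebra_simps)
qed

text \<open>Newton's identities as a generating function: each factor \<open>1 - k X\<close>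
  contributes \<open>- k / (1 - k X)\<close>, a geometric series.\<close>

lemma fps_deriv_recip_prod:
  "fps_deriv (fps_of_poly (recip_prod e N))
     = - fps_of_poly (recip_prod e N) * Abs_fps (\<lambda>j. \<Sum>k\<le>N. real (e k) * real k ^ Suc j)"
proof -
  define L where "L k = Abs_fps (\<lambda>j. real k ^ j)" for k
  have ring: "- (c * (f * l)) * g + f * (- g * (d * l)) = - (f * g) * ((c + d) * l)"
    for c d f g l :: "real fps" by (simp add: algebra_simps)
  have step: "fps_deriv (fps_of_poly ([:1, - real k:] ^ m))
      = - fps_of_poly ([:1, - real k:] ^ m) * (fps_const (real m * real k) * L k)" for k m
  proof (induction m)
    case (Suc m)
    have d: "fps_deriv (fps_of_poly [:1, - real k:]) = - fps_const (real k)"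
      by (simp add: fps_of_poly_pCons fps_of_poly_const)
    let ?f = "fps_of_poly [:1, - real k:]" 
    have "fps_deriv (fps_of_poly ([:1, - real k:] ^ Suc m)) =
        - fps_const (real k) * fps_of_poly ([:1, - real k:] ^ m) + ?f * 
        (- fps_of_poly ([:1, - real k:] ^ m) * (fps_const (real m * real k) * L k))"
      by (simp only: power_Suc fps_of_poly_mult fps_deriv_mult d Suc.IH) (simp add: algebra_simps)
    \<comment> \<open>Inserting \<open>?f * L k = 1\<close> gives both summands the common factor
      \<open>L k\<close>.\<close>
    also have "fps_const (real k) = fps_const (real k) * (?f * L k)"
      by (simp add: geometric_fps L_def)
    also have "- (fps_const (real k) * (?f * L k)) * fps_of_poly ([:1, - real k:] ^ m) + ?f * 
        (- fps_of_poly ([:1, - real k:] ^ m) * (fps_const (real m * real k) * L k)) =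
        - (?f * fps_of_poly ([:1, - real k:] ^ m)) * ((fps_const (real k) + fps_const (real m * real k)) * L k)"
      by (rule ring)
    also have "fps_const (real k) + fps_const (real m * real k) = fps_const (real (Suc m) * real k)"
      by (simp add: algebra_simps)
    finally show ?case by (simp only: power_Suc fps_of_poly_mult)
  qed simp
  have "fps_deriv (fps_of_poly (\<Prod>k\<in>S. [:1, - real k:] ^ e k)) =
      - fps_of_poly (\<Prod>k\<in>S. [:1, - real k:] ^ e k) * (\<Sum>k\<in>S. fps_const (real (e k) * real k) * L k)"
    if "finite S" for S
    using that
  proof (induction S rule: finite_induct)
    case (insert k S)
    show ?case unfolding prod.insert[OF insert(1,2)] sum.insert[OF insert(1,2)]
        fps_of_poly_mult fps_deriv_mult insert(3) step
      by (simp add: algebra_simps)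
  qed simp
  moreover have "(\<Sum>k\<le>N. fps_const (real (e k) * real k) * L k)
      = Abs_fps (\<lambda>j. \<Sum>k\<le>N. real (e k) * real k ^ Suc j)"
    by (rule fps_ext) (simp add: fps_sum_nth L_def mult_ac)
  ultimately show ?thesis by (simp add: recip_prod_def)
qed

lemma recip_prod_nz: "recip_prod e N \<noteq> 0"
  by (simp add: recip_prod_def)

lemma coeff_0_recip_prod: "coeff (recip_prod e N) 0 = 1"
  unfolding poly_0_coeff_0[symmetric] by (simp add: recip_prod_def poly_prod)

text \<open>By Newton's identities coefficient \<open>i\<close> depends only on earlier coefficients
  and on power sums of exponent at most \<open>i\<close>, hence strong induction.\<close>

lemma recip_prod_coeff_eq:
  assumes ps: "\<And>i. i < n \<Longrightarrow> (\<Sum>k\<le>N. (real (a k) - real (b k)) * real k ^ i) = 0" and "i < n"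
  shows "coeff (recip_prod a N) i = coeff (recip_prod b N) i"
  using assms(2)
proof (induction i rule: less_induct)
  case (less i)
  define u v where "u = fps_of_poly (recip_prod a N)" and "v = fps_of_poly (recip_prod b N)"
  define Su Sv where "Su = Abs_fps (\<lambda>j. \<Sum>k\<le>N. real (a k) * real k ^ Suc j)"
    and "Sv = Abs_fps (\<lambda>j. \<Sum>k\<le>N. real (b k) * real k ^ Suc j)"
  show ?case
  proof (cases i)
    case 0
    then show ?thesis by (simp add: coeff_0_recip_prod)
  next
    case (Suc m)
    \<comment> \<open>This splitting separates the two sources of difference: \<open>u - v\<close>
      vanishes up to index \<open>m\<close> by induction, \<open>Su - Sv\<close> by
      \<open>ps\<close>.\<close>
    have "fps_deriv (u - v) = - ((u - v) * Su + v * (Su - Sv))"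
      by (simp add: u_def v_def Su_def Sv_def fps_deriv_recip_prod algebra_simps)
    then have "fps_deriv (u - v) $ m = - (((u - v) * Su) $ m) - (v * (Su - Sv)) $ m" by simp
    also have "((u - v) * Su) $ m = 0"
      unfolding fps_mult_nth using less Suc by (intro sum.neutral) (auto simp: u_def v_def)
    also have "(Su - Sv) $ j = 0" if "j \<le> m" for j
    proof -
      have "(Su - Sv) $ j = (\<Sum>k\<le>N. (real (a k) - real (b k)) * real k ^ Suc j)"
        by (simp add: Su_def Sv_def sum_subtractf algebra_simps)
      then show ?thesis using ps[of "Suc j"] that less.prems Suc by simp
    qed
    then have "(v * (Su - Sv)) $ m = 0"
      unfolding fps_mult_nth by (intro sum.neutral) auto
    finally show ?thesis using Suc by (simp add: u_def v_def)
  qed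
qed

text \<open>Vanishing moments annihilate every polynomial; the test polynomial \<open>q\<close>
  vanishes at all nodes except \<open>k\<close>.\<close>

lemma moments_determine:
  fixes c :: "nat \<Rightarrow> real"
  assumes "\<And>i. (\<Sum>k\<le>N. c k * real k ^ i) = 0" "k \<le> N"
  shows "c k = 0"
proof -
  define q where "q = (\<Prod>l\<in>{..N} - {k}. [:- real l, 1:])"
  have "(\<Sum>j\<le>N. c j * poly q (real j)) = (\<Sum>i\<le>degree q. coeff q i * (\<Sum>j\<le>N. c j * real j ^ i))"
    unfolding poly_altdef sum_distrib_left by (subst sum.swap) (simp add: mult_ac)
  also have "\<dots> = 0" using assms by simp
  also have "(\<Sum>j\<le>N. c j * poly q (real j)) = (\<Sum>j\<in>{k}. c j * poly q (real j))"
    using assms(2) by (intro sum.mono_neutral_right) (auto simp: q_def poly_prod)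
  finally show ?thesis by (auto simp: q_def poly_prod)
qed

text \<open>If fewer than \<open>n\<close> positive units occur, the reciprocal
  polynomials \<open>\<Prod>(1 - k X)\<close> over the positive and the negative exponents have degree below \<open>n\<close>, while
  equality of their power sums forces them to agree up to \<open>X ^ n\<close>.\<close>

lemma sum_abs_coeff_ge:
  fixes p :: "int poly"
  assumes dvd: "[:-1, 1:] ^ n dvd p" and "p \<noteq> 0"
  shows "2 * int n \<le> (\<Sum>k\<le>degree p. \<bar>coeff p k\<bar>)"
proof (cases "n = 0")
  case False
  define N where "N = degree p"
  define a b where "a k = nat (coeff p k)" and "b k = nat (- coeff p k)" for k
  have ps: "(\<Sum>k\<le>N. (real (a k) - real (b k)) * real k ^ i) = 0" if "i < n" for i
  proof -
    have "(\<Sum>k\<le>N. (real (a k) - real (b k)) * real k ^ i) = of_int (\<Sum>k\<le>N. coeff p k * int k ^ i)"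
      unfolding of_int_sum by (intro sum.cong) (auto simp: a_def b_def)
    moreover have "(\<Sum>k\<le>N. coeff p k * int k ^ i) = 0"
      using power_sums_vanish[OF dvd that, of N] by (simp add: N_def)
    ultimately show ?thesis by (simp only: of_int_0)
  qed
  define m where "m = (\<Sum>k\<le>N. a k)"
  \<comment> \<open>The power sum of exponent 0 is available since \<open>n\<close> is nonzero; it
    makes the two multisets equally large.\<close>
  have "real m = real (\<Sum>k\<le>N. b k)"
    using ps[of 0] False by (simp add: m_def sum_subtractf)
  then have m: "m = (\<Sum>k\<le>N. b k)" by linarith
  have "n \<le> m"
  proof (rule ccontr)
    assume "\<not> n \<le> m"
    have "coeff (recip_prod a N) i = coeff (recip_prod b N) i" for i
    proof (cases "i < n")
      case True
      then show ?thesis using recip_prod_coeff_eq[OF ps] by blast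
    next
      case False
      then show ?thesis
        using degree_recip_prod[of a N] degree_recip_prod[of b N] \<open>\<not> n \<le> m\<close> m m_def
        by (simp add: coeff_eq_0)
    qed
    then have eq: "recip_prod a N = recip_prod b N" by (rule poly_eqI)
    let ?S = "\<lambda>e. Abs_fps (\<lambda>j. \<Sum>k\<le>N. real (e k) * real k ^ Suc j)"
    \<comment> \<open>Equal polynomials have equal logarithmic derivatives, so all power sums of
      positive exponent agree; exponent 0 is supplied by \<open>ps\<close>.\<close>
    have "- fps_of_poly (recip_prod b N) * ?S a = - fps_of_poly (recip_prod b N) * ?S b"
      using trans[OF sym[OF fps_deriv_recip_prod[of a N, unfolded eq]] fps_deriv_recip_prod[of b N]] .
    then have "?S a = ?S b" by (simp add: recip_prod_nz)
    then have "?S a $ j = ?S b $ j" for j by simp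
    then have "(\<Sum>k\<le>N. (real (a k) - real (b k)) * real k ^ Suc j) = 0" for j
      by (simp add: sum_subtractf algebra_simps)
    with ps False have "(\<Sum>k\<le>N. (real (a k) - real (b k)) * real k ^ i) = 0" for i
      by (cases i) blast+
    then have "real (a N) - real (b N) = 0"
      using moments_determine[of "\<lambda>k. real (a k) - real (b k)" N N] by blast
    then have "coeff p N = 0" by (auto simp: a_def b_def split: if_splits)
    with \<open>p \<noteq> 0\<close> show False by (simp add: N_def)
  qed
  have "(\<Sum>k\<le>N. \<bar>coeff p k\<bar>) = (\<Sum>k\<le>N. int (a k) + int (b k))"
    by (intro sum.cong) (auto simp: a_def b_def)
  also have "\<dots> = int (\<Sum>k\<le>N. a k) + int (\<Sum>k\<le>N. b k)" by (simp add: sum.distrib)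
  also have "\<dots> = 2 * int m" using m m_def by simp
  finally show ?thesis using \<open>n \<le> m\<close> by (simp add: N_def)
qed (simp add: sum_nonneg)

section \<open>Mean square versus maximum\<close>

text \<open>The radius stays below 1 because \<open>h\<close>, the denominator of
  \<open>\<phi>\<close>, vanishes at any multiple zero of \<open>p\<close> on the unit circle. Here
  \<open>h\<close> is \<open>D\<close> times the \<open>H\<close> of the introduction.\<close>

lemma sum_norm_coeff_square_le_radius:
  fixes p :: "complex poly"
  assumes unit: "\<And>a. poly p a = 0 \<Longrightarrow> cmod a = 1" and D: "degree p > 0"
    and M: "\<And>z. cmod z = 1 \<Longrightarrow> cmod (poly p z) \<le> M" and "M > 0" and r: "0 < r" "r < 1"
  shows "(\<Sum>k\<le>degree p. (cmod (coeff p k))\<^sup>2 * r ^ (2 * k)) \<le> M\<^sup>2 / 2"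
proof -
  define D where "D = degree p"
  define h where "h = smult (of_nat D) p - pCons 0 (pderiv p)"
  have h: "poly h z = of_nat D * poly p z - z * poly (pderiv p) z" for z
    by (simp add: h_def)
  define \<phi> where "\<phi> z = - (z * poly (pderiv p) z) / poly h z" for z
  have "D > 0" using D by (simp add: D_def)
  have h_le: "cmod (poly h z) \<le> D * M / 2" if "cmod z \<le> 1" for z
    by (rule poly_maximum_modulus[OF _ that])
      (use norm_reversed_deriv_le[OF unit D M _ \<open>M > 0\<close>] in \<open>auto simp: h D_def\<close>)
  have p_nz: "poly p z \<noteq> 0" if "cmod z < 1" for z
    using unit that by force
  have deriv_le: "cmod (z * poly (pderiv p) z) \<le> cmod (poly h z)" if "cmod z < 1" for z
    unfolding h D_def using that by (intro norm_logderiv_le D) (use unit in fastforce)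
  have h_nz: "poly h z \<noteq> 0" if "cmod z < 1" for z
  proof
    \<comment> \<open>Then \<open>z p'\<close> vanishes as well, and so does \<open>D p\<close>,
      although \<open>p\<close> has no zero in the open disc.\<close>
    assume "poly h z = 0"
    with deriv_le[OF that] have "z * poly (pderiv p) z = 0" by simp
    with \<open>poly h z = 0\<close> p_nz[OF that] \<open>D > 0\<close> show False by (simp add: h)
  qed
  have bound: "(cmod (poly p z))\<^sup>2 \<le> M\<^sup>2 / 2 * (1 - Re (\<phi> z))" if z: "cmod z < 1" for z
  proof -
    have "cmod (\<phi> z) \<le> 1"
      using deriv_le[OF z] h_nz[OF z] by (simp add: \<phi>_def norm_divide norm_mult)
    then have "(cmod (\<phi> z))\<^sup>2 \<le> 1" by (simp add: power_le_one)
    then have "(cmod (1 - \<phi> z))\<^sup>2 \<le> 2 - 2 * Re (\<phi> z)"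
      unfolding cmod_power2 by (simp add: power2_eq_square algebra_simps)
    moreover have "(cmod (poly h z))\<^sup>2 \<le> (D * M / 2)\<^sup>2"
      using h_le[of z] z by (intro power_mono) auto
    ultimately have "(cmod (poly h z))\<^sup>2 * (cmod (1 - \<phi> z))\<^sup>2 \<le> (D * M / 2)\<^sup>2 * (2 - 2 * Re (\<phi> z))"
      by (intro mult_mono) auto
    moreover have "of_nat D * poly p z = poly h z * (1 - \<phi> z)"
      using h_nz[OF z] by (simp add: \<phi>_def h field_simps)
    then have "(cmod (of_nat D * poly p z))\<^sup>2 = (cmod (poly h z))\<^sup>2 * (cmod (1 - \<phi> z))\<^sup>2"
      by (simp add: norm_mult power_mult_distrib)
    ultimately have "(real D)\<^sup>2 * (cmod (poly p z))\<^sup>2 \<le> (real D)\<^sup>2 * (M\<^sup>2 / 2 * (1 - Re (\<phi> z)))"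
      by (simp add: norm_mult power_mult_distrib power_divide algebra_simps)
    then show ?thesis using \<open>D > 0\<close> by simp
  qed
  have "\<phi> holomorphic_on cball 0 r"
    unfolding \<phi>_def using h_nz r by (intro holomorphic_intros) auto
  then have "((\<lambda>t. \<phi> (of_real r * cis t)) has_integral 2 * of_real pi * \<phi> 0) {0..2*pi}"
    using r by (intro circle_integral_holomorphic)
  from has_integral_Re[OF this]
  have "((\<lambda>t. Re (\<phi> (of_real r * cis t))) has_integral 0) {0..2*pi}"
    by (simp add: \<phi>_def[of 0])
  then have "((\<lambda>t. M\<^sup>2 / 2 * (1 - Re (\<phi> (of_real r * cis t)))) has_integral M\<^sup>2 / 2 * (2 * pi - 0)) {0..2*pi}"
    using has_integral_const_real[of "1::real" 0 "2 * pi"]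
    by (intro has_integral_mult_right has_integral_diff) auto
  then have "2 * pi * (\<Sum>k\<le>degree p. (cmod (coeff p k))\<^sup>2 * r ^ (2 * k)) \<le> M\<^sup>2 / 2 * (2 * pi - 0)"
    by (rule has_integral_le[OF circle_integral_norm_poly_square[OF r(1)]])
      (rule bound, use r in \<open>simp add: norm_mult\<close>)
  then show ?thesis by simp
qed

text \<open>The finite sum is continuous in the radius, so \<open>r\<close> may tend to 1 from the
  left.\<close>

lemma sum_norm_coeff_square_le:
  fixes p :: "complex poly"
  assumes unit: "\<And>a. poly p a = 0 \<Longrightarrow> cmod a = 1" and D: "degree p > 0"
    and M: "\<And>z. cmod z = 1 \<Longrightarrow> cmod (poly p z) \<le> M" and "M > 0"
  shows "(\<Sum>k\<le>degree p. (cmod (coeff p k))\<^sup>2) \<le> M\<^sup>2 / 2"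
proof -
  let ?f = "\<lambda>r::real. \<Sum>k\<le>degree p. (cmod (coeff p k))\<^sup>2 * r ^ (2 * k)"
  have "(?f \<longlongrightarrow> ?f 1) (at_left 1)"
    by (intro tendsto_intros)
  moreover have "\<forall>\<^sub>F r in at_left (1::real). 0 < r \<and> r < 1"
    using eventually_at_left_real[of 0 "1::real"] by (auto elim: eventually_mono)
  then have "\<forall>\<^sub>F r in at_left (1::real). ?f r \<le> M\<^sup>2 / 2"
    by eventually_elim (use sum_norm_coeff_square_le_radius[OF assms] in auto)
  ultimately have "?f 1 \<le> M\<^sup>2 / 2"
    by (rule tendsto_upperbound) auto
  then show ?thesis by simp
qed

section \<open>The products over \<open>1 - z ^ s j\<close> and the final bound\<close>

text \<open>Generic in the ring: the coefficient bound needs integers, the mean square bound complex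
  numbers.\<close>

definition es_poly :: "nat \<Rightarrow> (nat \<Rightarrow> nat) \<Rightarrow> 'a::comm_ring_1 poly" where
  "es_poly n s = (\<Prod>j = 1..n. 1 - monom 1 (s j))"

lemma root_power_dvd_es_poly: "[:-1, 1:] ^ n dvd (es_poly n s :: int poly)"
proof -
  have "[:-1, 1:] dvd (1 - monom 1 k :: int poly)" for k
    using poly_eq_0_iff_dvd[of "1 - monom 1 k" "1::int"] by (simp add: poly_monom)
  then have "(\<Prod>j = 1..n. [:-1, 1:]) dvd (es_poly n s :: int poly)"
    unfolding es_poly_def by (intro prod_dvd_prod)
  then show ?thesis by simp
qed

lemma poly_es_poly: "poly (es_poly n s) z = (\<Prod>j = 1..n. 1 - z ^ s j)"
  by (simp add: es_poly_def poly_prod poly_monom)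

lemma coeff_es_poly_Suc:
  "coeff (es_poly (Suc n) s) k = coeff (es_poly n s) k -
     (if s (Suc n) \<le> k then coeff (es_poly n s) (k - s (Suc n)) else 0)"
  by (simp add: es_poly_def algebra_simps coeff_monom_mult)

lemma coeff_es_poly: "coeff (es_poly n s) k = of_int (coeff (es_poly n s) k)"
  by (induction n arbitrary: k) (simp add: es_poly_def, simp add: coeff_es_poly_Suc)

text \<open>With integer coefficients \<open>a k\<close> of the product, \<open>2 n \<le> \<Sum>
  \<bar>a k\<bar> \<le> \<Sum> (a k)\<^sup>2 \<le> M\<^sup>2 / 2\<close>.\<close>

lemma circle_bound_ge:
  assumes s: "\<And>j. j \<in> {1..n} \<Longrightarrow> s j \<ge> 1" and "n \<ge> 1" and "M > 0"
    and M: "\<And>z::complex. cmod z = 1 \<Longrightarrow> cmod (\<Prod>j = 1..n. 1 - z ^ s j) \<le> M"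
  shows "2 * sqrt (real n) \<le> M"
proof -
  define p :: "int poly" where "p = es_poly n s"
  define P :: "complex poly" where "P = es_poly n s"
  have P: "poly P z = (\<Prod>j = 1..n. 1 - z ^ s j)" for z
    by (simp add: P_def poly_es_poly)
  have coeff: "coeff P k = of_int (coeff p k)" for k
    unfolding P_def p_def by (rule coeff_es_poly)
  then have map: "P = map_poly of_int p" by (intro poly_eqI) (simp add: coeff_map_poly)
  have deg: "degree P = degree p" by (simp add: map degree_map_poly)
  have unit: "cmod a = 1" if "poly P a = 0" for a
  proof -
    from that obtain j where j: "j \<in> {1..n}" "a ^ s j = 1" by (auto simp: P)
    then show ?thesis using s[OF j(1)] power_eq_1_iff[OF j(2)] by simp
  qed
  \<comment> \<open>Positivity of the exponents enters here; the values 1 at 0 and 0 at 1 show that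
    \<open>P\<close> is not constant.\<close>
  have "poly P 0 = 1" using s by (force simp: P power_0_left intro!: prod.neutral)
  then have "p \<noteq> 0" by (auto simp: map)
  have "poly P 1 = 0" using \<open>n \<ge> 1\<close> by (auto simp: P intro!: bexI[of _ 1])
  then have "degree P > 0" using \<open>poly P 0 = 1\<close>
    by (metis degree_eq_zeroE gr0I poly_const_conv zero_neq_one)
  then have "(\<Sum>k\<le>degree P. (cmod (coeff P k))\<^sup>2) \<le> M\<^sup>2 / 2"
    using unit M \<open>M > 0\<close> by (intro sum_norm_coeff_square_le) (auto simp: P)
  also have "(\<Sum>k\<le>degree P. (cmod (coeff P k))\<^sup>2) = of_int (\<Sum>k\<le>degree p. (coeff p k)\<^sup>2)"
    by (simp add: coeff deg)
  finally have *: "of_int (\<Sum>k\<le>degree p. (coeff p k)\<^sup>2) \<le> M\<^sup>2 / 2" .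
  have "2 * int n \<le> (\<Sum>k\<le>degree p. \<bar>coeff p k\<bar>)"
    using sum_abs_coeff_ge root_power_dvd_es_poly \<open>p \<noteq> 0\<close> by (simp add: p_def)
  also have "\<dots> \<le> (\<Sum>k\<le>degree p. (coeff p k)\<^sup>2)"
  proof (rule sum_mono)
    fix k show "\<bar>coeff p k\<bar> \<le> (coeff p k)\<^sup>2"
      using self_le_power[of "\<bar>coeff p k\<bar>" 2] by (cases "coeff p k = 0") auto
  qed
  finally have "real_of_int (2 * int n) \<le> of_int (\<Sum>k\<le>degree p. (coeff p k)\<^sup>2)"
    by (simp only: of_int_le_iff)
  with * have "4 * real n \<le> M\<^sup>2" by simp
  then have "sqrt (4 * real n) \<le> M" using \<open>M > 0\<close> by (intro real_le_lsqrt) auto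
  then show ?thesis by (simp add: real_sqrt_mult)
qed

theorem theorem1p2:
  fixes n :: nat
  assumes "n \<ge> 1"
  shows "erdos_szekeres_f n \<ge> 2 * sqrt (real n)"
  unfolding erdos_szekeres_f_def
proof (rule cINF_greatest[OF tuples_nonempty])
  fix s assume s: "s \<in> {1..n} \<rightarrow>\<^sub>E {1::nat..}"
  have "cmod (\<Prod>j = 1..n. 1 - z ^ s j) \<le> circle_max n s" if "cmod z = 1" for z
    using circle_max_attained[of n s] that by auto
  \<comment> \<open>The slack \<open>e\<close> supplies a strictly positive bound from mere
    nonnegativity of \<open>circle_max\<close>.\<close>
  then have "2 * sqrt (real n) \<le> circle_max n s + e" if "e > 0" for e
    using circle_max_nonneg[of n s] that s assms
    by (intro circle_bound_ge[of n s]) (auto simp: PiE_iff intro: add_nonneg_pos add_increasing2)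
  then show "2 * sqrt (real n) \<le> circle_max n s"
    by (rule field_le_epsilon)
qed

end
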